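(* Let $\Sigma=E_1+\cdots+E_m$ be the Minkowski sum of the ellipsoids $E_j=\{A_j\mathbf v:\ \mathbf v\in\mathbb{R}^N,\ \|\mathbf v\|<1\}$ in $\mathbb{R}^N$, $j=1,\dots,m$, where each $A_j$ is a symmetric positive-definite $N\times N$ real matrix. For $\mathbf u\in\mathbb{S}^{N-1}$ let $$A(\mathbf u)=\left(\sum_{j=1}^m\|A_j\mathbf u\|\right)^{1/2}\left(\sum_{i=1}^m\frac{A_i^2}{\|A_i\mathbf u\|}\right)^{1/2},$$ and let $\mathbf l\in\mathbb{S}^{N-1}$ be a unit vector that minimizes $\det A(\mathbf u)$ over $\mathbf u\in\mathbb{S}^{N-1}$. Then $$\mathrm{Vol}_N(\Sigma)\le\frac{[\det A(\mathbf l)]^{1/N}}{N}\,\mathrm{Vol}_{N-1}(\partial\Sigma).$$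
   Context: $\|\cdot\|$ is the Euclidean norm, $\mathbb{S}^{N-1}$ the unit sphere in $\mathbb{R}^N$; the Minkowski sum is $B_1+B_2=\{\mathbf x+\mathbf y:\mathbf x\in B_1,\mathbf y\in B_2\}$. The square root of a symmetric positive-definite matrix is the symmetric positive-definite one. $\mathrm{Vol}_N$ is Lebesgue measure in $\mathbb{R}^N$ and, for $S\subset\mathbb{R}^N$, $$\mathrm{Vol}_{N-1}(S):=\liminf_{\epsilon\to0}\frac{\mathrm{Vol}_N\{\mathbf x\in\mathbb{R}^N:\mathrm{dist}(\mathbf x,S)<\epsilon\}}{2\epsilon},$$ which for piecewise smooth hypersurfaces is the usual $(N-1)$-dimensional volume. *)

theory Defs
  imports "HOL-Analysis.Analysis" "HOL-Library.Set_Algebras"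
begin

definition sym_pos_def :: "real ^ 'n ^ 'n \<Rightarrow> bool" where
  "sym_pos_def M \<longleftrightarrow> transpose M = M \<and> (\<forall>x. x \<noteq> 0 \<longrightarrow> 0 < x \<bullet> (M *v x))"

text \<open>Only meaningful for symmetric positive-definite arguments, which have exactly one
  symmetric positive-definite square root.\<close>

definition spd_sqrt :: "real ^ 'n ^ 'n \<Rightarrow> real ^ 'n ^ 'n" where
  "spd_sqrt M = (THE B. sym_pos_def B \<and> B ** B = M)"

definition ellipsoid :: "real ^ 'n ^ 'n \<Rightarrow> (real ^ 'n) set" where
  "ellipsoid M = {M *v v | v. norm v < 1}"

text \<open>Addition of sets is pointwise, so this \<open>\<Sum>\<close> is the iterated Minkowski sum.\<close>

definition ellipsoid_sum :: "nat \<Rightarrow> (nat \<Rightarrow> real ^ 'n ^ 'n) \<Rightarrow> (real ^ 'n) set" where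
  "ellipsoid_sum m A = (\<Sum>j\<in>{1..m}. ellipsoid (A j))"

definition direction_matrix ::
    "nat \<Rightarrow> (nat \<Rightarrow> real ^ 'n ^ 'n) \<Rightarrow> real ^ 'n \<Rightarrow> real ^ 'n ^ 'n" where
  "direction_matrix m A u =
     sqrt (\<Sum>j\<in>{1..m}. norm (A j *v u)) *\<^sub>R
     spd_sqrt (\<Sum>i\<in>{1..m}. (1 / norm (A i *v u)) *\<^sub>R (A i ** A i))"

text \<open>The conjunct \<open>S \<noteq> {}\<close> is needed because \<open>infdist x {} = 0\<close>, whereas the distance to the
  empty set is \<open>\<infinity>\<close>.  The value is an extended real because the lower limit may be infinite.\<close>

definition Vol_codim1 :: "(real ^ 'n) set \<Rightarrow> ennreal" where
  "Vol_codim1 S =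
     Liminf (at_right 0) (\<lambda>\<epsilon>::real.
       emeasure lebesgue {x. S \<noteq> {} \<and> infdist x S < \<epsilon>} / ennreal (2 * \<epsilon>))"

end

theory Submission
  imports Defs
begin

text \<open>Two facts give the inequality.

  The first is an inclusion: for every direction \<open>u\<close>, the sum \<open>\<Sigma>\<close> of the ellipsoids lies in the single
  ellipsoid that is the image of the unit ball under the direction matrix \<open>P = A(u)\<close>.  Indeed the
  support function of \<open>\<Sigma>\<close> at \<open>x\<close> is \<open>\<Sum>\<^sub>j \<parallel>A\<^sub>j x\<parallel>\<close>, and the Cauchy-Schwarz inequality bounds it by
  \<open>\<parallel>P x\<parallel>\<close> (lemmas \<open>norm_sum_le_norm_direction_matrix\<close> and \<open>ellipsoid_sum_subset_ellipsoid\<close>).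

  The second is an isoperimetric inequality for any measurable set \<open>S\<close> inside the image of the unit
  ball under a symmetric positive-definite \<open>P\<close>: its volume is at most \<open>(det P)\<^sup>1\<^sup>/\<^sup>n / n\<close> times its surface area
  (theorem \<open>isoperimetric_in_ellipsoid\<close>).  It does not go through the Brunn-Minkowski inequality.
  The linear map \<open>T = 1 + \<epsilon> P\<^sup>-\<^sup>1\<close> moves every point of \<open>S\<close> by less than \<open>\<epsilon>\<close>, so the volume that \<open>T S\<close> gains
  outside \<open>S\<close>, and likewise the volume of those points of \<open>S\<close> that \<open>T\<close> carries out of \<open>S\<close>, lies within
  \<open>\<epsilon>\<close> of the frontier.  The determinant of \<open>T\<close> measures these volumes, and the arithmetic-geometric
  mean inequality for the eigenvalues of \<open>P\<^sup>-\<^sup>1\<close> bounds it below by \<open>1 + \<epsilon> n / (det P)\<^sup>1\<^sup>/\<^sup>n\<close>.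

  The spectral theorem for symmetric matrices supports both parts.  It shows that the square root
  in the direction matrix exists and is unique, supplies the eigenvalues, and reduces the volume of
  images under symmetric matrices to orthogonal and diagonal ones.\<close>

section \<open>The spectral theorem and square roots\<close>

lemma symmetric_inner:
  fixes M :: "real ^ 'n ^ 'n"
  assumes "transpose M = M"
  shows "(M *v x) \<bullet> y = x \<bullet> (M *v y)"
  using assms by (metis dot_lmul_matrix transpose_matrix_vector)

text \<open>A maximizer of the Rayleigh quotient over the unit sphere of an invariant subspace is an
  eigenvector: with \<open>c\<close> the maximum, a nonzero residual \<open>w = M x - c x\<close> would lie in the subspace and
  be orthogonal to \<open>x\<close>, and
  moving from \<open>x\<close> a little in its direction would raise the quotient to first order.\<close>

lemma symmetric_eigenvector_in_invariant_subspace: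
  fixes M :: "real ^ 'n ^ 'n"
  assumes sym: "transpose M = M" and S: "subspace S" and inv: "\<And>x. x \<in> S \<Longrightarrow> M *v x \<in> S"
    and ne: "z \<in> S" "z \<noteq> 0"
  obtains x c where "x \<in> S" "norm x = 1" "M *v x = c *\<^sub>R x"
proof -
  let ?K = "S \<inter> sphere 0 1"
  let ?q = "\<lambda>x. x \<bullet> (M *v x)"
  have "compact ?K"
    using S by (simp add: closed_subspace closed_Int_compact)
  moreover have "(1 / norm z) *\<^sub>R z \<in> ?K"
    using ne S by (simp add: subspace_scale)
  moreover have "continuous_on ?K ?q"
    by (intro continuous_on_inner continuous_on_id matrix_vector_mult_linear_continuous_on)
  ultimately obtain x where x: "x \<in> ?K" and max: "\<And>y. y \<in> ?K \<Longrightarrow> ?q y \<le> ?q x"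
    using continuous_attains_sup[of ?K ?q] by blast
  define c where "c = ?q x"
  have nx: "norm x = 1" "x \<in> S" using x by auto
  have le: "?q y \<le> c * (norm y)\<^sup>2" if "y \<in> S" for y
  proof (cases "y = 0")
    case False
    then have "(1 / norm y) *\<^sub>R y \<in> ?K"
      using that S by (simp add: subspace_scale)
    from max[OF this] have "?q y / (norm y)\<^sup>2 \<le> c"
      by (simp add: c_def matrix_vector_mult_scaleR power2_eq_square)
    then show ?thesis using False by (simp add: field_simps)
  qed simp
  define w where "w = M *v x - c *\<^sub>R x"
  have wS: "w \<in> S"
    using nx inv S by (simp add: w_def subspace_diff subspace_scale)
  have xw: "x \<bullet> w = 0"
    using nx by (simp add: w_def inner_diff_right c_def dot_square_norm)
  (* The bound on the quadratic form at x + t w: the terms of order zero in t cancel, and the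
     term linear in t is the squared norm of the residual. *)
  have ineq: "2 * t * (norm w)\<^sup>2 \<le> t\<^sup>2 * (c * (norm w)\<^sup>2 - ?q w)" for t
  proof -
    have "x + t *\<^sub>R w \<in> S"
      using nx wS S by (simp add: subspace_add subspace_scale)
    from le[OF this] have *: "?q (x + t *\<^sub>R w) \<le> c * (norm (x + t *\<^sub>R w))\<^sup>2" .
    have "(norm (x + t *\<^sub>R w))\<^sup>2 = 1 + t\<^sup>2 * (norm w)\<^sup>2"
      unfolding power2_norm_eq_inner using nx xw
      by (simp add: inner_commute inner_simps power2_eq_square norm_eq_1)
    moreover have "?q (x + t *\<^sub>R w) = c + 2 * t * (w \<bullet> (M *v x)) + t\<^sup>2 * ?q w"
      using symmetric_inner[OF sym, of x w]
      by (simp add: c_def matrix_vector_mult_scaleR matrix_vector_right_distrib inner_simps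
          inner_commute power2_eq_square distrib_left)
    moreover have "w \<bullet> (M *v x) = (norm w)\<^sup>2"
    proof -
      have "M *v x = w + c *\<^sub>R x" by (simp add: w_def)
      then show ?thesis using xw
        by (simp only: inner_simps) (simp add: inner_commute power2_norm_eq_inner)
    qed
    ultimately show ?thesis using * by (simp add: algebra_simps)
  qed
  have "w = 0"
  proof (rule ccontr)
    assume "w \<noteq> 0"
    (* For small t > 0 the linear term wins; b only has to be positive and to exceed the
       coefficient of the square of t. *)
    define a b where "a = (norm w)\<^sup>2" and "b = \<bar>c * (norm w)\<^sup>2 - ?q w\<bar> + 1"
    have "a > 0" "b > 0" using \<open>w \<noteq> 0\<close> by (auto simp: a_def b_def)
    define t where "t = a / b"
    have "t > 0" using \<open>a > 0\<close> \<open>b > 0\<close> by (simp add: t_def)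
    have "2 * t * a \<le> t\<^sup>2 * b"
      using ineq[of t] mult_left_mono[of "c * (norm w)\<^sup>2 - ?q w" b "t\<^sup>2"]
      unfolding a_def b_def by fastforce
    also have "\<dots> = t * a" using \<open>b > 0\<close> by (simp add: t_def power2_eq_square)
    finally show False using \<open>t > 0\<close> \<open>a > 0\<close> by simp
  qed
  then show thesis using that nx by (simp add: w_def)
qed

text \<open>The symmetric matrix whose eigenvectors are the columns of the orthogonal matrix \<open>Q\<close>, with
  eigenvalues \<open>d\<close>.  For fixed \<open>Q\<close> these matrices form a commutative algebra in which sums, products
  and determinants are computed on the eigenvalues, so that square roots and inverses come for free.\<close>

definition spectral_matrix :: "real ^ 'n ^ 'n \<Rightarrow> ('n \<Rightarrow> real) \<Rightarrow> real ^ 'n ^ 'n" where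
  "spectral_matrix Q d = Q ** (\<chi> i j. if i = j then d i else 0) ** transpose Q"

lemma spectral_matrix_nth:
  "spectral_matrix Q d $ i $ j = (\<Sum>k\<in>UNIV. d k * (Q $ i $ k * Q $ j $ k))"
  by (simp add: spectral_matrix_def matrix_matrix_mult_def transpose_def mult_delta_right mult_ac)

lemma spectral_matrix_add: "spectral_matrix Q (\<lambda>i. d i + e i) = spectral_matrix Q d + spectral_matrix Q e"
  by (simp add: vec_eq_iff spectral_matrix_nth algebra_simps sum.distrib)

lemma spectral_matrix_scaleR: "spectral_matrix Q (\<lambda>i. c * d i) = c *\<^sub>R spectral_matrix Q d"
  by (simp add: vec_eq_iff spectral_matrix_nth sum_distrib_left mult.assoc)

lemma transpose_spectral_matrix: "transpose (spectral_matrix Q d) = spectral_matrix Q d"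
  by (simp add: vec_eq_iff spectral_matrix_nth transpose_def mult.commute)

lemma spectral_matrix_one:
  assumes "orthogonal_matrix Q"
  shows "spectral_matrix Q (\<lambda>_. 1) = mat 1"
proof -
  have "(\<chi> i j. if i = j then 1 else 0) = (mat 1 :: real ^ 'a ^ 'a)"
    by (simp add: mat_def)
  then show ?thesis
    using assms by (simp add: spectral_matrix_def orthogonal_matrix_def)
qed

lemma spectral_matrix_mult:
  assumes "orthogonal_matrix Q"
  shows "spectral_matrix Q d ** spectral_matrix Q e = spectral_matrix Q (\<lambda>i. d i * e i)"
proof -
  let ?D = "\<lambda>d. (\<chi> i j. if i = j then d i else 0) :: real ^ 'a ^ 'a"
  have D: "?D d ** ?D e = ?D (\<lambda>i. d i * e i)"
    by (simp add: matrix_matrix_mult_def vec_eq_iff mult_delta_left)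
  have "spectral_matrix Q d ** spectral_matrix Q e
      = Q ** ?D d ** (transpose Q ** Q) ** ?D e ** transpose Q"
    by (simp add: spectral_matrix_def matrix_mul_assoc)
  also have "\<dots> = Q ** (?D d ** ?D e) ** transpose Q"
    using assms by (simp add: orthogonal_matrix_def matrix_mul_assoc)
  finally show ?thesis by (simp add: D spectral_matrix_def)
qed

lemma det_spectral_matrix:
  assumes "orthogonal_matrix Q"
  shows "det (spectral_matrix Q d) = (\<Prod>i\<in>UNIV. d i)"
proof -
  have "det Q * det Q = 1"
    using det_orthogonal_matrix[OF assms] by auto
  then show ?thesis
    by (simp add: spectral_matrix_def det_mul det_diagonal mult_ac)
qed

lemma spectral_matrix_column:
  assumes "orthogonal_matrix Q"
  shows "spectral_matrix Q d *v column k Q = d k *\<^sub>R column k Q"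
proof -
  have "transpose Q *v column k Q = axis k 1"
    using assms by (simp add: matrix_vector_mul_assoc orthogonal_matrix_def
        flip: matrix_vector_mult_basis del: transpose_matrix_vector)
  moreover have "(\<chi> i j. if i = j then d i else 0) *v axis k 1 = d k *\<^sub>R (axis k 1 :: real ^ 'a)"
    unfolding matrix_vector_mult_basis by (simp add: column_def vec_eq_iff axis_def)
  moreover have "spectral_matrix Q d *v column k Q
      = Q *v ((\<chi> i j. if i = j then d i else 0) *v (transpose Q *v column k Q))"
    by (simp only: spectral_matrix_def matrix_vector_mul_assoc matrix_mul_assoc)
  ultimately show ?thesis
    by (simp only: matrix_vector_mult_scaleR matrix_vector_mult_basis)
qed

lemma matrix_eq_on_columns:
  fixes M :: "real ^ 'n ^ 'n"
  assumes Q: "orthogonal_matrix Q" and eq: "\<And>k. M *v column k Q = M' *v column k Q"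
  shows "M = M'"
proof -
  have "M ** Q = M' ** Q"
    using eq by (simp add: vec_eq_iff matrix_vector_mult_def matrix_matrix_mult_def column_def)
  then have "M ** (Q ** transpose Q) = M' ** (Q ** transpose Q)"
    by (simp add: matrix_mul_assoc)
  then show ?thesis using Q by (simp add: orthogonal_matrix_def)
qed

text \<open>Unit eigenvectors are collected one index at a time: the orthogonal complement of those
  already found is invariant under \<open>M\<close>, and it is nonzero while indices remain.\<close>

theorem symmetric_matrix_spectral:
  fixes M :: "real ^ 'n ^ 'n"
  assumes sym: "transpose M = M"
  obtains Q d where "orthogonal_matrix Q" "M = spectral_matrix Q d"
proof -
  have "finite I \<Longrightarrow> \<exists>q :: 'n \<Rightarrow> real ^ 'n. \<forall>i\<in>I. norm (q i) = 1 \<and> (\<exists>c. M *v q i = c *\<^sub>R q i)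
           \<and> (\<forall>j\<in>I. i \<noteq> j \<longrightarrow> orthogonal (q i) (q j))" for I
  proof (induction I rule: finite_induct)
    case (insert k I)
    then obtain q :: "'n \<Rightarrow> real ^ 'n" where q: "\<And>i. i \<in> I \<Longrightarrow> norm (q i) = 1"
      "\<And>i. i \<in> I \<Longrightarrow> \<exists>c. M *v q i = c *\<^sub>R q i"
      "\<And>i j. i \<in> I \<Longrightarrow> j \<in> I \<Longrightarrow> i \<noteq> j \<Longrightarrow> orthogonal (q i) (q j)"
      by blast
    let ?S = "{y. \<forall>i\<in>I. q i \<bullet> y = 0}"
    have "card (q ` I) < CARD('n)"
      using insert.hyps card_image_le[of I q] psubset_card_mono[of UNIV I] by fastforce
    then have "dim (q ` I) < DIM(real ^ 'n)"
      using dim_le_card'[of "q ` I"] insert.hyps by simp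
    then obtain z where z: "z \<noteq> 0" "\<And>y. y \<in> span (q ` I) \<Longrightarrow> orthogonal z y"
      using orthogonal_to_subspace_exists by blast
    have S: "subspace ?S"
      by (auto simp: subspace_def inner_simps)
    have inv: "M *v y \<in> ?S" if "y \<in> ?S" for y
    proof clarify
      fix i assume "i \<in> I"
      then obtain c where "M *v q i = c *\<^sub>R q i" using q(2) by blast
      then show "q i \<bullet> (M *v y) = 0"
        using symmetric_inner[OF sym, of "q i" y] that \<open>i \<in> I\<close> by simp
    qed
    have zS: "z \<in> ?S"
      using z(2)[OF span_base] by (simp add: orthogonal_def) (metis imageI inner_commute)
    obtain x c where x: "x \<in> ?S" "norm x = 1" "M *v x = c *\<^sub>R x"
      by (rule symmetric_eigenvector_in_invariant_subspace[OF sym S inv zS z(1)])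
    have "orthogonal x (q i)" "orthogonal (q i) x" if "i \<in> I" for i
      using x that by (auto simp: orthogonal_def inner_commute)
    then show ?case
      using q x insert.hyps by (intro exI[of _ "q(k := x)"]) auto
  qed auto
  from this[of UNIV] obtain q :: "'n \<Rightarrow> real ^ 'n" where q: "\<And>i. norm (q i) = 1"
    "\<And>i. \<exists>c. M *v q i = c *\<^sub>R q i" "\<And>i j. i \<noteq> j \<Longrightarrow> orthogonal (q i) (q j)"
    by auto
  define Q where "Q = (\<chi> i j. q j $ i)"
  have col: "column k Q = q k" for k
    by (simp add: Q_def column_def vec_eq_iff)
  have Q: "orthogonal_matrix Q"
    using q by (auto simp: orthogonal_matrix_orthonormal_columns col)
  obtain d where "\<And>i. M *v q i = d i *\<^sub>R q i" using q(2) by metis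
  then have "M = spectral_matrix Q d"
    using spectral_matrix_column[OF Q, of d]
    by (intro matrix_eq_on_columns[OF Q]) (simp add: col)
  with Q that show thesis by blast
qed

lemma spectral_matrix_pos_def_iff:
  assumes Q: "orthogonal_matrix Q"
  shows "sym_pos_def (spectral_matrix Q d) \<longleftrightarrow> (\<forall>i. 0 < d i)"
proof
  assume pd: "sym_pos_def (spectral_matrix Q d)"
  show "\<forall>i. 0 < d i"
  proof
    fix i
    have "norm (column i Q) = 1"
      using Q by (simp add: orthogonal_matrix_orthonormal_columns)
    moreover from this have "column i Q \<noteq> 0" by force
    ultimately show "0 < d i"
      using pd spectral_matrix_column[OF Q, of d i]
      by (auto simp: sym_pos_def_def dot_square_norm dest!: spec[of _ "column i Q"])
  qed
next
  assume d: "\<forall>i. 0 < d i"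
  have "0 < x \<bullet> (spectral_matrix Q d *v x)" if "x \<noteq> 0" for x
  proof -
    define y where "y = transpose Q *v x"
    have "Q *v y = x"
      using Q by (simp add: y_def matrix_vector_mul_assoc orthogonal_matrix_def del: transpose_matrix_vector)
    then have "y \<noteq> 0" using that by auto
    then obtain k where k: "y $ k \<noteq> 0" by (auto simp: vec_eq_iff)
    have "x \<bullet> (spectral_matrix Q d *v x) = y \<bullet> ((\<chi> i j. if i = j then d i else 0) *v y)"
      by (simp add: y_def spectral_matrix_def dot_lmul_matrix flip: matrix_vector_mul_assoc)
    also have "\<dots> = (\<Sum>i\<in>UNIV. d i * (y $ i)\<^sup>2)"
      by (simp add: inner_vec_def matrix_vector_mult_def mult_delta_left power2_eq_square mult.left_commute)
    also have "\<dots> > 0"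
      using d k by (intro sum_pos2[of _ k]) (auto simp: less_imp_le)
    finally show ?thesis .
  qed
  then show "sym_pos_def (spectral_matrix Q d)"
    by (simp add: sym_pos_def_def transpose_spectral_matrix)
qed

text \<open>A positive-definite root \<open>C\<close> of \<open>M\<close> is forced to act as \<open>sqrt c\<close> on every \<open>c\<close>-eigenvector of
  \<open>M\<close>, because \<open>M - c = (C + sqrt c) (C - sqrt c)\<close> and \<open>- sqrt c\<close> cannot be an eigenvalue of \<open>C\<close>.
  Since the eigenvectors span, this gives uniqueness of the root.\<close>

lemma pos_def_square_root_eigenvector:
  assumes C: "sym_pos_def C" and "C ** C = M" and ev: "M *v x = c *\<^sub>R x" and "c > 0"
  shows "C *v x = sqrt c *\<^sub>R x"
proof (rule ccontr)
  define w where "w = C *v x - sqrt c *\<^sub>R x"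
  assume "C *v x \<noteq> sqrt c *\<^sub>R x"
  then have "w \<noteq> 0" by (simp add: w_def)
  have "C *v (C *v x) = (sqrt c * sqrt c) *\<^sub>R x"
    using assms by (simp add: matrix_vector_mul_assoc)
  then have "C *v w = - sqrt c *\<^sub>R w"
    by (simp add: w_def matrix_vector_mult_diff_distrib matrix_vector_mult_scaleR scaleR_diff_right)
  moreover have "0 < w \<bullet> (C *v w)"
    using C \<open>w \<noteq> 0\<close> by (simp add: sym_pos_def_def)
  moreover have "0 \<le> w \<bullet> w" "0 \<le> sqrt c" using \<open>c > 0\<close> by auto
  ultimately show False
    by (simp add: mult_less_0_iff zero_less_mult_iff not_less)
qed

text \<open>The description operator in the definition of \<^const>\<open>spd_sqrt\<close> denotes a genuine square root:
  existence comes from taking roots of the eigenvalues, uniqueness from the previous lemma.\<close>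

theorem spd_sqrt:
  assumes M: "sym_pos_def M"
  shows "sym_pos_def (spd_sqrt M)" "spd_sqrt M ** spd_sqrt M = M"
proof -
  obtain Q d where Q: "orthogonal_matrix Q" and Md: "M = spectral_matrix Q d"
    using M symmetric_matrix_spectral unfolding sym_pos_def_def by metis
  have d: "0 < d i" for i
    using M Q by (simp add: Md spectral_matrix_pos_def_iff)
  let ?B = "spectral_matrix Q (\<lambda>i. sqrt (d i))"
  have B: "sym_pos_def ?B \<and> ?B ** ?B = M"
    using Q d by (simp add: Md spectral_matrix_pos_def_iff spectral_matrix_mult less_imp_le)
  moreover have "C = ?B" if "sym_pos_def C \<and> C ** C = M" for C
  proof (rule matrix_eq_on_columns[OF Q])
    fix k
    have ev: "M *v column k Q = d k *\<^sub>R column k Q"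
      using spectral_matrix_column[OF Q] by (simp add: Md)
    show "C *v column k Q = ?B *v column k Q"
      using that B pos_def_square_root_eigenvector[OF _ _ ev d] by metis
  qed
  ultimately have "sym_pos_def (spd_sqrt M) \<and> spd_sqrt M ** spd_sqrt M = M"
    unfolding spd_sqrt_def by (rule theI[where P = "\<lambda>B. sym_pos_def B \<and> B ** B = M"])
  then show "sym_pos_def (spd_sqrt M)" "spd_sqrt M ** spd_sqrt M = M" by auto
qed

section \<open>Determinants of positive-definite matrices\<close>

lemma pos_def_det_pos:
  assumes "sym_pos_def P"
  shows "0 < det P"
proof -
  obtain Q d where Q: "orthogonal_matrix Q" and P: "P = spectral_matrix Q d"
    using assms symmetric_matrix_spectral unfolding sym_pos_def_def by metis
  then show ?thesis
    using assms by (simp add: spectral_matrix_pos_def_iff det_spectral_matrix prod_pos)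
qed

lemma one_plus_sum_le_prod:
  fixes f :: "'a \<Rightarrow> real"
  assumes "finite I" "\<And>i. i \<in> I \<Longrightarrow> 0 \<le> f i"
  shows "1 + sum f I \<le> (\<Prod>i\<in>I. 1 + f i)"
  using assms
proof (induction I rule: finite_induct)
  case (insert k I)
  have "1 + sum f I \<le> (\<Prod>i\<in>I. 1 + f i)" "1 \<le> (\<Prod>i\<in>I. 1 + f i)"
    using insert by (auto intro!: prod_ge_1)
  then have "1 + sum f I + f k * 1 \<le> (\<Prod>i\<in>I. 1 + f i) + f k * (\<Prod>i\<in>I. 1 + f i)"
    using insert.prems by (intro add_mono mult_left_mono) auto
  then show ?case using insert.hyps by (simp add: algebra_simps)
qed simp

text \<open>With \<open>d\<^sub>i\<close> the eigenvalues of \<open>P\<close>, the determinant of \<open>1 + e R\<close> is \<open>\<Prod>\<^sub>i (1 + e / d\<^sub>i) \<ge> 1 + e (\<Sum>\<^sub>i 1 / d\<^sub>i)\<close>,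
  and the
  arithmetic-geometric mean inequality bounds the sum below by \<open>n / (det P)\<^sup>1\<^sup>/\<^sup>n\<close>.  This is where the constant of
  the isoperimetric inequality comes from.\<close>

lemma pos_def_inverse_det_bound:
  fixes P :: "real ^ 'n ^ 'n"
  assumes P: "sym_pos_def P"
  obtains R where "sym_pos_def R" "R ** P = mat 1"
    "\<And>e. 0 \<le> e \<Longrightarrow> 1 + e * (real CARD('n) / det P powr (1 / real CARD('n))) \<le> det (mat 1 + e *\<^sub>R R)"
proof -
  obtain Q d where Q: "orthogonal_matrix Q" and Pd: "P = spectral_matrix Q d"
    using P symmetric_matrix_spectral unfolding sym_pos_def_def by metis
  have d: "0 < d i" for i
    using P Q by (simp add: Pd spectral_matrix_pos_def_iff)
  let ?N = "real CARD('n)"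
  define R where "R = spectral_matrix Q (\<lambda>i. 1 / d i)"
  have "sym_pos_def R"
    using Q d by (simp add: R_def spectral_matrix_pos_def_iff)
  moreover have "d i \<noteq> 0" for i using d[of i] by simp
  then have "R ** P = mat 1"
    using Q by (simp add: R_def Pd spectral_matrix_mult spectral_matrix_one)
  moreover have "1 + e * (?N / det P powr (1 / ?N)) \<le> det (mat 1 + e *\<^sub>R R)" if "0 \<le> e" for e
  proof -
    have "(\<Prod>i\<in>UNIV. 1 / d i) powr (1 / ?N) \<le> (\<Sum>i\<in>UNIV. 1 / d i / ?N)"
      using d by (intro arith_geom_mean) (auto simp: less_imp_le)
    moreover have "(\<Prod>i\<in>UNIV. 1 / d i) = 1 / det P"
      using Q by (simp add: Pd det_spectral_matrix prod_dividef)
    ultimately have "1 / det P powr (1 / ?N) \<le> (\<Sum>i\<in>UNIV. 1 / d i) / ?N"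
      using pos_def_det_pos[OF P] by (simp add: powr_divide sum_divide_distrib)
    then have "?N / det P powr (1 / ?N) \<le> (\<Sum>i\<in>UNIV. 1 / d i)"
      by (simp add: pos_le_divide_eq)
    then have "1 + e * (?N / det P powr (1 / ?N)) \<le> 1 + (\<Sum>i\<in>UNIV. e * (1 / d i))"
      unfolding sum_distrib_left[symmetric] using that by (intro add_left_mono mult_left_mono)
    also have "\<dots> \<le> (\<Prod>i\<in>UNIV. 1 + e * (1 / d i))"
      using d that by (intro one_plus_sum_le_prod) (simp_all add: less_imp_le)
    also have "\<dots> = det (mat 1 + e *\<^sub>R R)"
      unfolding R_def spectral_matrix_scaleR[symmetric] spectral_matrix_one[OF Q, symmetric]
        spectral_matrix_add[symmetric] by (simp add: det_spectral_matrix[OF Q])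
    finally show ?thesis .
  qed
  ultimately show thesis by (rule that)
qed

section \<open>Volumes of images under symmetric matrices\<close>

text \<open>Image measures under linear maps, over an arbitrary finite index type: a linear map is a
  product of elementary ones, each of which multiplies volumes by a constant.  The value of the
  constant is left open here; it is found for orthogonal and for diagonal matrices, and the
  spectral decomposition then covers the symmetric ones.\<close>

lemma linear_image_measure_proportional:
  fixes f :: "real ^ 'n \<Rightarrow> real ^ 'n"
  assumes "linear f"
  shows "\<exists>c. \<forall>S\<in>lmeasurable. f ` S \<in> lmeasurable \<and> measure lebesgue (f ` S) = c * measure lebesgue S"
proof (rule induct_linear_elementary[OF assms])
  fix f g :: "real ^ 'n \<Rightarrow> real ^ 'n"
  assume "\<exists>c. \<forall>S\<in>lmeasurable. f ` S \<in> lmeasurable \<and> measure lebesgue (f ` S) = c * measure lebesgue S"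
    and "\<exists>c. \<forall>S\<in>lmeasurable. g ` S \<in> lmeasurable \<and> measure lebesgue (g ` S) = c * measure lebesgue S"
  then obtain c d where
    "\<forall>S\<in>lmeasurable. f ` S \<in> lmeasurable \<and> measure lebesgue (f ` S) = c * measure lebesgue S"
    "\<forall>S\<in>lmeasurable. g ` S \<in> lmeasurable \<and> measure lebesgue (g ` S) = d * measure lebesgue S"
    by blast
  then show "\<exists>c. \<forall>S\<in>lmeasurable. (f \<circ> g) ` S \<in> lmeasurable \<and> measure lebesgue ((f \<circ> g) ` S) = c * measure lebesgue S"
    unfolding image_comp[symmetric] by (intro exI[of _ "c * d"]) simp
next
  fix f :: "real ^ 'n \<Rightarrow> real ^ 'n" and i
  assume "\<And>x. f x $ i = 0"
  then have "negligible (f ` S)" for S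
    by (intro negligible_subset[OF negligible_standard_hyperplane_cart[of i]]) auto
  then show "\<exists>c. \<forall>S\<in>lmeasurable. f ` S \<in> lmeasurable \<and> measure lebesgue (f ` S) = c * measure lebesgue S"
    by (intro exI[of _ 0]) (simp add: negligible_iff_measure)
next
  fix c :: "'n \<Rightarrow> real"
  show "\<exists>d. \<forall>S\<in>lmeasurable. (\<lambda>x. \<chi> i. c i * x $ i) ` S \<in> lmeasurable \<and>
      measure lebesgue ((\<lambda>x. \<chi> i. c i * x $ i) ` S) = d * measure lebesgue S"
    by (intro exI[of _ "\<bar>prod c UNIV\<bar>"]) (simp add: measurable_stretch measure_stretch)
next
  fix m n :: 'n
  assume "m \<noteq> n"
  define f :: "real ^ 'n \<Rightarrow> real ^ 'n"
    where "f = (\<lambda>x::real^'n. \<chi> i. x $ Transposition.transpose m n i)"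
  have f_nth: "f x $ i = x $ Transposition.transpose m n i" for x i
    by (simp add: f_def)
  have lin: "linear f"
    by (rule linearI) (simp_all add: vec_eq_iff f_nth)
  have inv: "f (f x) = x" for x
    by (simp add: vec_eq_iff f_nth)
  have "measure lebesgue (f ` cbox a b) = 1 * measure lebesgue (cbox a b)" for a b
  proof -
    have mem: "f x \<in> cbox (f u) (f v)" if "x \<in> cbox u v" for x u v
      using that by (simp add: mem_box_cart f_nth)
    have "y \<in> f ` cbox a b" if "y \<in> cbox (f a) (f b)" for y
      using mem[OF that] by (intro image_eqI[of _ _ "f y"]) (simp_all only: inv)
    then have img: "f ` cbox a b = cbox (f a) (f b)"
      using mem by blast
    have "(\<Prod>i\<in>UNIV. f b $ i - f a $ i) = (\<Prod>i\<in>UNIV. b $ i - a $ i)"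
      using prod.permute[of "Transposition.transpose m n" UNIV "\<lambda>i. b $ i - a $ i"]
      by (simp add: permutes_swap_id o_def f_nth)
    moreover have "cbox (f a) (f b) = {} \<longleftrightarrow> cbox a b = {}"
      using img by blast
    ultimately show ?thesis
      unfolding img by (simp add: content_cbox_if_cart)
  qed
  then have "\<forall>S\<in>lmeasurable. f ` S \<in> lmeasurable \<and> measure lebesgue (f ` S) = 1 * measure lebesgue S"
    using measure_linear_sufficient[OF lin] by metis
  then show "\<exists>c. \<forall>S\<in>lmeasurable. (\<lambda>x::real^'n. \<chi> i. x $ Transposition.transpose m n i) ` S \<in> lmeasurable \<and>
      measure lebesgue ((\<lambda>x::real^'n. \<chi> i. x $ Transposition.transpose m n i) ` S) = c * measure lebesgue S"
    unfolding f_def by (intro exI[of _ 1])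
next
  fix m n :: 'n
  assume mn: "m \<noteq> n"
  define f :: "real ^ 'n \<Rightarrow> real ^ 'n"
    where "f = (\<lambda>x. \<chi> i. if i = m then x $ m + x $ n else x $ i)"
  have lin: "linear f"
    by (rule linearI) (auto simp: f_def vec_eq_iff algebra_simps)
  have "measure lebesgue (f ` cbox a b) = 1 * measure lebesgue (cbox a b)" for a b
  proof (cases "cbox a b = {}")
    case False
    (* The volume of a sheared box is known when the n-th coordinate is nonnegative on the box;
       translating by w puts that coordinate of the lower corner at zero. *)
    define w where "w = (\<chi> i. if i = n then - a $ n else 0)"
    have shift: "cbox (w + a) (w + b) = (+) w ` cbox a b"
      by (rule cbox_translation)
    have "f ` (+) w ` cbox a b = (+) (f w) ` f ` cbox a b"
      unfolding image_image linear_add[OF lin] by (rule refl)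
    then have "measure lebesgue (f ` cbox a b) = measure lebesgue (f ` cbox (w + a) (w + b))"
      unfolding shift by (simp only: measure_translation)
    also have "\<dots> = measure lebesgue (cbox (w + a) (w + b))"
      unfolding f_def
    proof (rule measure_shear_interval[OF mn])
      show "cbox (w + a) (w + b) \<noteq> {}" using False unfolding shift by blast
      show "0 \<le> (w + a) $ n" by (simp add: w_def)
    qed
    finally show ?thesis
      by (simp only: shift measure_translation mult_1)
  qed simp
  then have "\<forall>S\<in>lmeasurable. f ` S \<in> lmeasurable \<and> measure lebesgue (f ` S) = 1 * measure lebesgue S"
    using measure_linear_sufficient[OF lin] by metis
  then show "\<exists>c. \<forall>S\<in>lmeasurable. (\<lambda>x::real^'n. \<chi> i. if i = m then x $ m + x $ n else x $ i) ` S \<in> lmeasurable \<and>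
      measure lebesgue ((\<lambda>x::real^'n. \<chi> i. if i = m then x $ m + x $ n else x $ i) ` S) = c * measure lebesgue S"
    unfolding f_def by (intro exI[of _ 1])
qed

text \<open>The unknown factor is read off from the unit ball, which an orthogonal matrix maps to itself.\<close>

lemma orthogonal_matrix_image_measure:
  fixes Q :: "real ^ 'n ^ 'n"
  assumes "orthogonal_matrix Q" and S: "S \<in> lmeasurable"
  shows "(*v) Q ` S \<in> lmeasurable" "measure lebesgue ((*v) Q ` S) = measure lebesgue S"
proof -
  obtain c where c: "\<And>S. S \<in> lmeasurable \<Longrightarrow> (*v) Q ` S \<in> lmeasurable"
    "\<And>S. S \<in> lmeasurable \<Longrightarrow> measure lebesgue ((*v) Q ` S) = c * measure lebesgue S"
    using linear_image_measure_proportional[of "(*v) Q"] by auto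
  have "orthogonal_transformation ((*v) Q)"
    using assms(1) by (simp add: orthogonal_transformation_matrix)
  then have "(*v) Q ` ball 0 1 = ball 0 1"
    by (simp add: image_orthogonal_transformation_ball)
  then have "c = 1"
    using c(2)[of "ball 0 1"] content_ball_pos[of 1 "0 :: real ^ 'n"] by simp
  with c S show "(*v) Q ` S \<in> lmeasurable" "measure lebesgue ((*v) Q ` S) = measure lebesgue S"
    by auto
qed

lemma symmetric_matrix_image_measure:
  fixes M :: "real ^ 'n ^ 'n"
  assumes "transpose M = M" and S: "S \<in> lmeasurable"
  shows "(*v) M ` S \<in> lmeasurable" "measure lebesgue ((*v) M ` S) = \<bar>det M\<bar> * measure lebesgue S"
proof -
  obtain Q d where Q: "orthogonal_matrix Q" and M: "M = spectral_matrix Q d"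
    using assms(1) symmetric_matrix_spectral by blast
  have Q': "orthogonal_matrix (transpose Q)" using Q by simp
  have D: "(\<chi> i j. if i = j then d i else 0) *v x = (\<chi> i. d i * x $ i)" for x :: "real ^ 'n"
    by (simp add: vec_eq_iff matrix_vector_mult_def mult_delta_left)
  have "(*v) M ` S = (*v) Q ` (\<lambda>x. \<chi> i. d i * x $ i) ` (*v) (transpose Q) ` S"
    by (simp add: M spectral_matrix_def image_image D del: transpose_matrix_vector flip: matrix_vector_mul_assoc)
  then show "(*v) M ` S \<in> lmeasurable" "measure lebesgue ((*v) M ` S) = \<bar>det M\<bar> * measure lebesgue S"
    by (simp_all only: orthogonal_matrix_image_measure[OF Q] orthogonal_matrix_image_measure[OF Q']
        measurable_stretch measure_stretch S M det_spectral_matrix[OF Q])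
qed

section \<open>An isoperimetric inequality inside an ellipsoid\<close>

lemma ellipsoid_eq_image: "ellipsoid M = (*v) M ` ball 0 1"
  by (auto simp: ellipsoid_def)

lemma bounded_ellipsoid: "bounded (ellipsoid M)"
  unfolding ellipsoid_eq_image by (intro bounded_linear_image bounded_ball) auto

text \<open>A segment that joins a point of \<open>S\<close> to a point outside crosses the frontier of \<open>S\<close>.\<close>

lemma infdist_frontier_less:
  fixes S :: "'a :: real_normed_vector set"
  assumes "x \<in> S" "y \<notin> S" "dist x y < e"
  shows "infdist x (frontier S) < e" "infdist y (frontier S) < e"
proof -
  obtain z where z: "z \<in> closed_segment x y" "z \<in> frontier S"
    using connected_Int_frontier[of "closed_segment x y" S] assms(1,2) by auto
  then have "dist x z \<le> dist x y" "dist y z \<le> dist x y"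
    using segment_bound[OF z(1)] by (auto simp: dist_norm norm_minus_commute)
  then show "infdist x (frontier S) < e" "infdist y (frontier S) < e"
    using infdist_le[OF z(2)] assms(3) by (meson order.trans le_less_trans)+
qed

text \<open>Let \<open>R\<close> be the inverse of \<open>P\<close> and \<open>T = 1 + e R\<close>.  Since \<open>R\<close> maps \<open>S\<close> into the unit ball, \<open>T\<close> moves
  each point of \<open>S\<close> by less than \<open>e\<close>.  So a point of \<open>S\<close> that \<open>T\<close> moves out of \<open>S\<close> is, as is its
  image, within \<open>e\<close> of the frontier.  Hence the \<open>e\<close>-neighbourhood \<open>N\<close> of the frontier contains
  \<open>T S - S\<close>, of volume at least \<open>(t - 1) V\<close> with \<open>t = det T\<close> and \<open>V\<close> the volume of \<open>S\<close>; and \<open>T\<close> maps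
  \<open>S - N\<close> into \<open>S\<close>, so that \<open>S \<inter> N\<close> has volume at least \<open>(1 - 1 / t) V\<close>.  To first
  order both bounds are at least \<open>e k V\<close>, where \<open>k = n / (det P)\<^sup>1\<^sup>/\<^sup>n\<close>; dividing their sum by \<open>2 e\<close> and letting \<open>e\<close> tend to \<open>0\<close>
  gives \<open>k V\<close> as a lower bound for the surface area.\<close>

theorem isoperimetric_in_ellipsoid:
  fixes P :: "real ^ 'n ^ 'n" and S :: "(real ^ 'n) set"
  assumes P: "sym_pos_def P" and S: "S \<in> lmeasurable" and sub: "S \<subseteq> ellipsoid P"
  shows "emeasure lebesgue S \<le>
    ennreal (det P powr (1 / real CARD('n)) / real CARD('n)) * Vol_codim1 (frontier S)"
proof (cases "S = {}")
  case False
  obtain R where R: "sym_pos_def R" "R ** P = mat 1" and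
    det: "\<And>e. 0 \<le> e \<Longrightarrow> 1 + e * (real CARD('n) / det P powr (1 / real CARD('n))) \<le> det (mat 1 + e *\<^sub>R R)"
    using pos_def_inverse_det_bound[OF P] by blast
  define k where "k = real CARD('n) / det P powr (1 / real CARD('n))"
  define V where "V = measure lebesgue S"
  have k: "k > 0"
    using pos_def_det_pos[OF P] by (simp add: k_def)
  have V: "V \<ge> 0" "emeasure lebesgue S = ennreal V"
    using S by (simp_all add: V_def emeasure_eq_measure2)
  have RS: "norm (R *v s) < 1" if s: "s \<in> S" for s
  proof -
    obtain v where "s = P *v v" "norm v < 1"
      using sub s unfolding ellipsoid_def by blast
    then show ?thesis using R(2) by (simp add: matrix_vector_mul_assoc)
  qed
  (* An empty frontier would have surface area zero by definition. *)
  have "bounded S"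
    by (rule bounded_subset[OF bounded_ellipsoid sub])
  then have ne: "frontier S \<noteq> {}"
    using False frontier_not_empty not_bounded_UNIV by metis
  (* (s - 1 / s) V / (2 e) for s = 1 + e k, the lower bound for det T; the quotient by e has been
     carried out, so that the limit at 0 can be taken by substitution. *)
  let ?g = "\<lambda>e. V * (k * (2 + e * k) / (2 * (1 + e * k)))"
  have main: "ennreal (?g e) \<le> emeasure lebesgue {x. frontier S \<noteq> {} \<and> infdist x (frontier S) < e} / ennreal (2 * e)"
    if e: "e > 0" for e
  proof -
    define T where "T = mat 1 + e *\<^sub>R R"
    define N where "N = {x. infdist x (frontier S) < e}"
    have Tx: "T *v x = x + e *\<^sub>R (R *v x)" for x
      by (simp add: T_def matrix_vector_mult_add_rdistrib scaleR_matrix_vector_assoc)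
    have dT: "dist x (T *v x) < e" if "x \<in> S" for x
      using RS[OF that] e by (simp add: Tx dist_norm)
    have "transpose T = T"
      using R(1) by (simp add: T_def sym_pos_def_def transpose_def vec_eq_iff mat_def)
    note T = symmetric_matrix_image_measure[OF this]
    define t where "t = det T"
    have t: "1 + e * k \<le> t" using det[of e] e by (simp add: t_def T_def k_def)
    have ek: "0 < e * k" using e k by simp
    have "open N"
      unfolding N_def by (intro open_Collect_less continuous_on_infdist continuous_intros)
    then have NL: "N \<in> sets lebesgue" by auto
    have m1: "S - N \<in> lmeasurable" "S \<inter> N \<in> lmeasurable" "(*v) T ` S - S \<in> lmeasurable"
      using S NL T(1)[OF S] by (auto intro: fmeasurable.Diff fmeasurable_Int_fmeasurable fmeasurable_Diff)
    have "(*v) T ` (S - N) \<subseteq> S"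
      using infdist_frontier_less(1) dT unfolding N_def by blast
    then have "measure lebesgue ((*v) T ` (S - N)) \<le> V"
      unfolding V_def using S T(1)[OF m1(1)] by (intro measure_mono_fmeasurable) auto
    then have "t * measure lebesgue (S - N) \<le> V"
      using T(2)[OF m1(1)] t ek by (simp add: t_def)
    then have "measure lebesgue (S - N) \<le> V / t"
      using t ek by (simp add: pos_le_divide_eq mult.commute)
    moreover have "V \<le> measure lebesgue (S \<inter> N) + measure lebesgue (S - N)"
      using measure_Un_le[of "S \<inter> N" lebesgue "S - N"] m1 by (simp add: V_def Int_Diff_Un)
    ultimately have inner: "V - V / t \<le> measure lebesgue (S \<inter> N)"
      by simp
    have "t * V = measure lebesgue ((*v) T ` S)"
      using T(2)[OF S] t ek by (simp add: t_def V_def)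
    also have "\<dots> \<le> measure lebesgue (((*v) T ` S - S) \<union> S)"
      using S m1 T(1)[OF S] by (intro measure_mono_fmeasurable) auto
    also have "\<dots> \<le> measure lebesgue ((*v) T ` S - S) + V"
      unfolding V_def using S m1 by (intro measure_Un_le) auto
    finally have outer: "t * V - V \<le> measure lebesgue ((*v) T ` S - S)" by simp
    have "(*v) T ` S - S \<subseteq> N"
      using infdist_frontier_less(2) dT unfolding N_def by blast
    then have "(S \<inter> N) \<union> ((*v) T ` S - S) \<subseteq> N" by blast
    then have "emeasure lebesgue N \<ge> emeasure lebesgue ((S \<inter> N) \<union> ((*v) T ` S - S))"
      using NL by (intro emeasure_mono) auto
    also have "emeasure lebesgue ((S \<inter> N) \<union> ((*v) T ` S - S)) =
        emeasure lebesgue (S \<inter> N) + emeasure lebesgue ((*v) T ` S - S)"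
      using m1 by (intro plus_emeasure[symmetric]) auto
    also have "\<dots> = ennreal (measure lebesgue (S \<inter> N) + measure lebesgue ((*v) T ` S - S))"
      using m1 by (simp add: emeasure_eq_measure2)
    finally have N: "ennreal (measure lebesgue (S \<inter> N) + measure lebesgue ((*v) T ` S - S)) \<le> emeasure lebesgue N" .
    have "?g e * (2 * e) = V * ((1 + e * k) - 1 / (1 + e * k))"
      using ek by (simp add: field_simps power2_eq_square)
    also have "\<dots> \<le> V * (t - 1 / t)"
      using V t ek by (intro mult_left_mono diff_mono divide_left_mono) auto
    also have "\<dots> \<le> measure lebesgue (S \<inter> N) + measure lebesgue ((*v) T ` S - S)"
      using inner outer by (simp add: algebra_simps)
    finally have "ennreal (?g e * (2 * e)) \<le> emeasure lebesgue N"
      using N ennreal_leI order.trans by blast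
    moreover have "ennreal (?g e * (2 * e)) = ennreal (?g e) * ennreal (2 * e)"
      using e k V by (intro ennreal_mult) auto
    ultimately have "ennreal (?g e) * ennreal (2 * e) \<le> emeasure lebesgue N"
      by simp
    then have "ennreal (?g e) \<le> emeasure lebesgue N / ennreal (2 * e)"
      using divide_right_mono_ennreal[of "ennreal (?g e) * ennreal (2 * e)" _ "ennreal (2 * e)"] e
      by (simp add: mult_divide_eq_ennreal)
    then show ?thesis using ne by (simp add: N_def)
  qed
  have "(?g \<longlongrightarrow> V * (k * (2 + 0 * k) / (2 * (1 + 0 * k)))) (at_right 0)"
    by (intro tendsto_intros) auto
  then have "((\<lambda>e. ennreal (?g e)) \<longlongrightarrow> ennreal (V * k)) (at_right 0)"
    by (intro tendsto_ennrealI) simp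
  then have "ennreal (V * k) = Liminf (at_right 0) (\<lambda>e. ennreal (?g e))"
    by (intro lim_imp_Liminf[symmetric]) auto
  also have "\<dots> \<le> Vol_codim1 (frontier S)"
    unfolding Vol_codim1_def
    by (intro Liminf_mono eventually_mono[OF eventually_at_right_less main])
  finally have "ennreal (V * k) \<le> Vol_codim1 (frontier S)" .
  then have "ennreal (1 / k) * ennreal (V * k) \<le> ennreal (1 / k) * Vol_codim1 (frontier S)"
    by (rule mult_left_mono) simp
  moreover have "ennreal (1 / k) * ennreal (V * k) = ennreal V"
    using k V by (simp flip: ennreal_mult')
  ultimately show ?thesis
    by (simp add: V(2) k_def)
qed simp

section \<open>The ellipsoid around a Minkowski sum of ellipsoids\<close>

lemma sum_matrix_vector_mult:
  fixes M :: "'a \<Rightarrow> real ^ 'n ^ 'm"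
  shows "sum M I *v x = (\<Sum>i\<in>I. M i *v x)"
  by (induction I rule: infinite_finite_induct) (simp_all add: matrix_vector_mult_add_rdistrib)

text \<open>With \<open>c\<close> the sum of the \<open>\<parallel>A\<^sub>j u\<parallel>\<close> and \<open>H\<close> the sum of the \<open>A\<^sub>j\<^sup>2 / \<parallel>A\<^sub>j u\<parallel>\<close>, the direction matrix is
  \<open>sqrt c\<close> times the root of \<open>H\<close>.  The inequality is that of Cauchy and Schwarz for the vectors with
  entries \<open>\<parallel>A\<^sub>j u\<parallel>\<^sup>1\<^sup>/\<^sup>2\<close> and \<open>\<parallel>A\<^sub>j x\<parallel> / \<parallel>A\<^sub>j u\<parallel>\<^sup>1\<^sup>/\<^sup>2\<close>; it compares the support function of the Minkowski
  sum with that of the ellipsoid of the direction matrix.\<close>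

lemma norm_sum_le_norm_direction_matrix:
  fixes A :: "nat \<Rightarrow> real ^ 'n ^ 'n" and m :: nat and u :: "real ^ 'n"
  assumes m: "m \<ge> 1" and A: "\<And>j. j \<in> {1..m} \<Longrightarrow> sym_pos_def (A j)" and u: "u \<noteq> 0"
  shows "sym_pos_def (direction_matrix m A u)"
    "(\<Sum>j\<in>{1..m}. norm (A j *v x)) \<le> norm (direction_matrix m A u *v x)"
proof -
  have nz: "0 < norm (A j *v x)" if "j \<in> {1..m}" "x \<noteq> 0" for j x
    using A[OF that(1)] that(2) unfolding sym_pos_def_def by force
  have sA: "(A j *v y) \<bullet> z = y \<bullet> (A j *v z)" if "j \<in> {1..m}" for j y z
    using A[OF that] by (intro symmetric_inner) (simp add: sym_pos_def_def)
  define H where "H = (\<Sum>i\<in>{1..m}. (1 / norm (A i *v u)) *\<^sub>R (A i ** A i))"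
  define c where "c = (\<Sum>j\<in>{1..m}. norm (A j *v u))"
  have qH: "x \<bullet> (H *v x) = (\<Sum>i\<in>{1..m}. (norm (A i *v x))\<^sup>2 / norm (A i *v u))" for x
  proof -
    have "H *v x = (\<Sum>i\<in>{1..m}. (1 / norm (A i *v u)) *\<^sub>R (A i *v (A i *v x)))"
      by (simp add: H_def sum_matrix_vector_mult matrix_vector_mul_assoc
          scaleR_matrix_vector_assoc[symmetric])
    then have "x \<bullet> (H *v x) = (\<Sum>i\<in>{1..m}. (1 / norm (A i *v u)) * (x \<bullet> (A i *v (A i *v x))))"
      by (simp add: inner_sum_right)
    also have "\<dots> = (\<Sum>i\<in>{1..m}. (norm (A i *v x))\<^sup>2 / norm (A i *v u))"
      by (intro sum.cong) (simp_all add: power2_norm_eq_inner sA)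
    finally show ?thesis .
  qed
  have "transpose H = H"
  proof -
    have "(A k ** A k) $ j $ i = (A k ** A k) $ i $ j" if "k \<in> {1..m}" for i j k
    proof -
      have "transpose (A k ** A k) = A k ** A k"
        using A[OF that] by (simp add: matrix_transpose_mul sym_pos_def_def)
      then have "transpose (A k ** A k) $ i $ j = (A k ** A k) $ i $ j" by simp
      then show ?thesis by (simp add: transpose_def)
    qed
    then show ?thesis
      by (simp add: H_def transpose_def vec_eq_iff)
  qed
  moreover have "0 < x \<bullet> (H *v x)" if "x \<noteq> 0" for x
    unfolding qH using nz u that m by (intro sum_pos divide_pos_pos zero_less_power) auto
  ultimately have "sym_pos_def H" by (simp add: sym_pos_def_def)
  note B = spd_sqrt[OF this]
  have "c > 0" unfolding c_def using nz u m by (intro sum_pos) auto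
  have P: "direction_matrix m A u = sqrt c *\<^sub>R spd_sqrt H"
    by (simp add: direction_matrix_def c_def H_def)
  show "sym_pos_def (direction_matrix m A u)"
    using B(1) \<open>c > 0\<close> unfolding P sym_pos_def_def
    by (auto simp: transpose_scalar scaleR_matrix_vector_assoc[symmetric] )
  have "(\<Sum>j\<in>{1..m}. norm (A j *v x))\<^sup>2
      = (\<Sum>j\<in>{1..m}. sqrt (norm (A j *v u)) * (norm (A j *v x) / sqrt (norm (A j *v u))))\<^sup>2"
    using nz u by (intro arg_cong[where f = "\<lambda>s. s\<^sup>2"] sum.cong) auto
  also have "\<dots> \<le> (\<Sum>j\<in>{1..m}. (sqrt (norm (A j *v u)))\<^sup>2) * (\<Sum>j\<in>{1..m}. (norm (A j *v x) / sqrt (norm (A j *v u)))\<^sup>2)"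
    by (rule Cauchy_Schwarz_ineq_sum)
  also have "\<dots> = c * (x \<bullet> (H *v x))"
    by (simp add: c_def qH power_divide)
  also have "x \<bullet> (H *v x) = (norm (spd_sqrt H *v x))\<^sup>2"
    using B symmetric_inner[of "spd_sqrt H" x "spd_sqrt H *v x"]
    by (simp add: sym_pos_def_def power2_norm_eq_inner matrix_vector_mul_assoc)
  also have "c * (norm (spd_sqrt H *v x))\<^sup>2 = (norm (direction_matrix m A u *v x))\<^sup>2"
    using \<open>c > 0\<close> by (simp add: P scaleR_matrix_vector_assoc[symmetric] power_mult_distrib)
  finally show "(\<Sum>j\<in>{1..m}. norm (A j *v x)) \<le> norm (direction_matrix m A u *v x)"
    by (rule power2_le_imp_le) simp
qed

text \<open>The hypothesis compares support functions, but the inclusion needs no separation theorem: for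
  \<open>s = \<Sum>\<^sub>j A\<^sub>j v\<^sub>j\<close> put \<open>w = P\<^sup>-\<^sup>1 s\<close> and test the hypothesis only at \<open>y = P\<^sup>-\<^sup>1 w\<close>.  If \<open>w \<noteq> 0\<close>, then
  \<open>\<parallel>w\<parallel>\<^sup>2 = \<Sum>\<^sub>j A\<^sub>j y \<bullet> v\<^sub>j < \<Sum>\<^sub>j \<parallel>A\<^sub>j y\<parallel> \<le> \<parallel>P y\<parallel> = \<parallel>w\<parallel>\<close>, whence \<open>\<parallel>w\<parallel> < 1\<close>.\<close>

lemma ellipsoid_sum_subset_ellipsoid:
  fixes A :: "nat \<Rightarrow> real ^ 'n ^ 'n"
  assumes m: "m \<ge> 1" and A: "\<And>j. j \<in> {1..m} \<Longrightarrow> sym_pos_def (A j)" and P: "sym_pos_def P"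
    and le: "\<And>x. (\<Sum>j\<in>{1..m}. norm (A j *v x)) \<le> norm (P *v x)"
  shows "ellipsoid_sum m A \<subseteq> ellipsoid P"
proof
  have sA: "(A j *v y) \<bullet> z = y \<bullet> (A j *v z)" if "j \<in> {1..m}" for j y z
    using A[OF that] by (intro symmetric_inner) (simp add: sym_pos_def_def)
  fix s assume "s \<in> ellipsoid_sum m A"
  then obtain f where f: "s = sum f {1..m}" "\<forall>j\<in>{1..m}. f j \<in> ellipsoid (A j)"
    by (auto simp: ellipsoid_sum_def set_sum_alt)
  then obtain v where v: "\<And>j. j \<in> {1..m} \<Longrightarrow> f j = A j *v v j \<and> norm (v j) < 1"
    unfolding ellipsoid_def mem_Collect_eq by metis
  obtain R where R: "sym_pos_def R" "R ** P = mat 1"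
    using pos_def_inverse_det_bound[OF P] by blast
  then have PR: "P ** R = mat 1" by (simp add: matrix_left_right_inverse)
  define w y where "w = R *v s" and "y = R *v w"
  have Pw: "P *v w = s" and Py: "P *v y = w"
    by (simp_all add: w_def y_def matrix_vector_mul_assoc PR matrix_mul_assoc)
  have "norm w < 1"
  proof (cases "w = 0")
    case False
    then have "y \<noteq> 0" using Py by auto
    have pos: "0 < norm (A j *v y)" if "j \<in> {1..m}" for j
      using A[OF that] \<open>y \<noteq> 0\<close> unfolding sym_pos_def_def by force
    have "(norm w)\<^sup>2 = y \<bullet> s"
      using symmetric_inner[of R w s] R(1)
      by (simp add: power2_norm_eq_inner sym_pos_def_def y_def flip: w_def)
    also have "\<dots> = (\<Sum>j\<in>{1..m}. (A j *v y) \<bullet> v j)"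
      unfolding f(1) inner_sum_right using v by (intro sum.cong) (simp_all add: sA)
    also have "\<dots> < (\<Sum>j\<in>{1..m}. norm (A j *v y))"
    proof (rule sum_strict_mono)
      fix j assume j: "j \<in> {1..m}"
      have "(A j *v y) \<bullet> v j \<le> norm (A j *v y) * norm (v j)"
        by (rule norm_cauchy_schwarz)
      also have "\<dots> < norm (A j *v y)"
        using pos[OF j] v[OF j] by simp
      finally show "(A j *v y) \<bullet> v j < norm (A j *v y)" .
    qed (use m in auto)
    also have "\<dots> \<le> norm w" using le[of y] by (simp add: Py)
    finally show ?thesis using False by (simp add: power2_eq_square)
  qed simp
  then show "s \<in> ellipsoid P" using Pw by (auto simp: ellipsoid_def)
qed

lemma convex_ellipsoid_sum: "convex (ellipsoid_sum m A)"
  unfolding ellipsoid_sum_def ellipsoid_eq_image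
  by (intro convex_set_sum convex_linear_image) auto

section \<open>The isoperimetric inequality for sums of ellipsoids\<close>

theorem theorem5p11:
  fixes A :: "nat \<Rightarrow> real ^ 'n ^ 'n" and m :: nat and l :: "real ^ 'n"
  assumes "m \<ge> 1"
    and "\<And>j. j \<in> {1..m} \<Longrightarrow> sym_pos_def (A j)"
    and "norm l = 1"
    and "\<And>u. norm u = 1 \<Longrightarrow> det (direction_matrix m A l) \<le> det (direction_matrix m A u)"
  shows "emeasure lebesgue (ellipsoid_sum m A) \<le>
    ennreal (det (direction_matrix m A l) powr (1 / real CARD('n)) / real CARD('n)) *
      Vol_codim1 (frontier (ellipsoid_sum m A))"
proof (rule isoperimetric_in_ellipsoid)
  have "l \<noteq> 0" using assms(3) by auto
  note P = norm_sum_le_norm_direction_matrix[OF assms(1,2) this]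
  show "sym_pos_def (direction_matrix m A l)" by (rule P)
  show sub: "ellipsoid_sum m A \<subseteq> ellipsoid (direction_matrix m A l)"
    by (rule ellipsoid_sum_subset_ellipsoid[OF assms(1,2) P])
  show "ellipsoid_sum m A \<in> lmeasurable"
    by (intro measurable_convex convex_ellipsoid_sum bounded_subset[OF bounded_ellipsoid sub])
qed

end
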